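(* Let $C(E)=E^b$ with $b\in\mathbb R$, $b\ge2$. Then $$C_{max}(a,d,e)\ \le\ 2^{b-1}\,(l_{max}+1)^b\,b^b\,C_{min}(a,d,e).$$
   Context: Total-energy model. Time is slotted with slots $1,\dots,T$; $[k,l]$ denotes the set of slots $\{k,\dots,l\}$. There are $n\ge1$ jobs $J=\{1,\dots,n\}$; job $j$ has demand $(a_j,d_j,e_j)$ with $a_j,d_j\in\{1,\dots,T\}$, $a_j\le d_j$, $e_j>0$ (arrival slot, deadline slot, total energy). The job allowance is $l_j=d_j-a_j+1$, and $l_{max}=\max_{j\in J}l_j$. Uncompromised operator's minimum cost: $$C_{min}(a,d,e)=\min_{\mathcal S}\sum_{t=1}^T C\Big(\sum_{j\in J}\mathcal S_{jt}\Big)$$ over $\mathcal S_{jt}\ge0$ with $\sum_{t=a_j}^{d_j}\mathcal S_{jt}=e_j$ for all $j\in J$. Optimal offline full attack cost: each job $j$ is served entirely in one slot $t_j\in[a_j,d_j]$, and $$C_{max}(a,d,e)=\max_{t_j\in[a_j,d_j],\,j\in J}\ \sum_{t=1}^T C\Big(\sum_{j\in J:\,t_j=t}e_j\Big).$$ *)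

theory Defs
  imports "HOL-Analysis.Analysis"
begin

text \<open>
  Jobs are \<open>1, \<dots>, n\<close> and slots \<open>1, \<dots>, T\<close>; functions on jobs and slots are total
  on \<^typ>\<open>nat\<close>; when all \<open>a j, d j\<close> lie in \<open>{1..T}\<close>, their values at other indices never enter. The demand of job \<open>j\<close> is
  \<open>(a j, d j, e j)\<close>.
\<close>

definition max_allowance :: "nat \<Rightarrow> (nat \<Rightarrow> nat) \<Rightarrow> (nat \<Rightarrow> nat) \<Rightarrow> nat" where
  "max_allowance n a d = Max ((\<lambda>j. d j - a j + 1) ` {1..n})"

definition feasible_schedules ::
    "nat \<Rightarrow> nat \<Rightarrow> (nat \<Rightarrow> nat) \<Rightarrow> (nat \<Rightarrow> nat) \<Rightarrow> (nat \<Rightarrow> real) \<Rightarrow> (nat \<Rightarrow> nat \<Rightarrow> real) set" where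
  "feasible_schedules T n a d e =
     {S. (\<forall>j\<in>{1..n}. \<forall>t\<in>{1..T}. S j t \<ge> 0) \<and> (\<forall>j\<in>{1..n}. (\<Sum>t=a j..d j. S j t) = e j)}"

definition schedule_cost :: "(real \<Rightarrow> real) \<Rightarrow> nat \<Rightarrow> nat \<Rightarrow> (nat \<Rightarrow> nat \<Rightarrow> real) \<Rightarrow> real" where
  "schedule_cost C T n S = (\<Sum>t=1..T. C (\<Sum>j=1..n. S j t))"

text \<open>
  The minimum is written as an infimum; lemma \<open>min_cost_attained\<close> below shows that it is
  attained for the power costs \<open>E powr b\<close> with \<open>b > 0\<close>.
\<close>

definition min_cost ::
    "(real \<Rightarrow> real) \<Rightarrow> nat \<Rightarrow> nat \<Rightarrow> (nat \<Rightarrow> nat) \<Rightarrow> (nat \<Rightarrow> nat) \<Rightarrow> (nat \<Rightarrow> real) \<Rightarrow> real" where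
  "min_cost C T n a d e = (INF S\<in>feasible_schedules T n a d e. schedule_cost C T n S)"

definition full_attack_max_cost ::
    "(real \<Rightarrow> real) \<Rightarrow> nat \<Rightarrow> nat \<Rightarrow> (nat \<Rightarrow> nat) \<Rightarrow> (nat \<Rightarrow> nat) \<Rightarrow> (nat \<Rightarrow> real) \<Rightarrow> real" where
  "full_attack_max_cost C T n a d e =
     Max ((\<lambda>s. \<Sum>t=1..T. C (\<Sum>j\<in>{j\<in>{1..n}. s j = t}. e j)) ` (\<Pi>\<^sub>E j\<in>{1..n}. {a j..d j}))"

lemma min_cost_attained:
  fixes T n :: nat and a d :: "nat \<Rightarrow> nat" and e :: "nat \<Rightarrow> real" and b :: real
  assumes b: "b > 0"
    and ad: "\<And>j. j \<in> {1..n} \<Longrightarrow> 1 \<le> a j \<and> a j \<le> d j \<and> d j \<le> T"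
    and e: "\<And>j. j \<in> {1..n} \<Longrightarrow> e j > 0"
  defines "C \<equiv> \<lambda>E::real. E powr b"
  shows "\<exists>S\<in>feasible_schedules T n a d e.
           min_cost C T n a d e = schedule_cost C T n S \<and>
           (\<forall>S'\<in>feasible_schedules T n a d e. schedule_cost C T n S \<le> schedule_cost C T n S')"
proof -
  define W where "W = (\<lambda>j t. j \<in> {1..n} \<and> t \<in> {a j..d j})"
  define B where "B = {S. \<forall>j t. S j t \<in> (if W j t then {0..e j} else {0})}"
  define K where "K = B \<inter> {S. \<forall>j\<in>{1..n}. (\<Sum>t=a j..d j. S j t) = e j}"
  have nnB: "0 \<le> S j t" if "S \<in> B" for S j t
  proof -
    have "S j t \<in> (if W j t then {0..e j} else {0})"
      using that unfolding B_def by blast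
    then show ?thesis by (simp split: if_splits)
  qed
  have coord: "continuous_on A (\<lambda>S::nat \<Rightarrow> nat \<Rightarrow> real. S j t)" for A j t
  proof -
    have "continuous_on UNIV (\<lambda>S::nat \<Rightarrow> nat \<Rightarrow> real. S j)" by simp
    then have "continuous_on UNIV (\<lambda>S::nat \<Rightarrow> nat \<Rightarrow> real. S j t)"
      by (rule continuous_on_product_then_coordinatewise)
    then show ?thesis by (rule continuous_on_subset) simp
  qed
  have "B = (\<Pi>\<^sub>E j\<in>UNIV. \<Pi>\<^sub>E t\<in>UNIV. if W j t then {0..e j} else {0})"
    by (auto simp: B_def PiE_def Pi_def)
  moreover have "compactin (product_topology (\<lambda>t. euclidean) UNIV)
      (\<Pi>\<^sub>E t\<in>UNIV. if W j t then {0..e j} else {0})" for j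
    unfolding compactin_PiE by auto
  then have "compactin (product_topology (\<lambda>j. euclidean) UNIV)
      (\<Pi>\<^sub>E j\<in>UNIV. \<Pi>\<^sub>E t\<in>UNIV. if W j t then {0..e j} else {0})"
    by (simp add: compactin_PiE flip: euclidean_product_topology)
  ultimately have "compact B"
    by (simp add: euclidean_product_topology flip: compactin_euclidean_iff)
  moreover have "closed {S::nat \<Rightarrow> nat \<Rightarrow> real. \<forall>j\<in>{1..n}. (\<Sum>t=a j..d j. S j t) = e j}"
    unfolding Ball_def
    by (intro closed_Collect_imp open_Collect_const closed_Collect_all closed_Collect_eq
        continuous_on_sum coord continuous_on_const)
  ultimately have "compact K"
    unfolding K_def by (rule compact_Int_closed)
  moreover have "(\<lambda>j t. if j \<in> {1..n} \<and> t = a j then e j else 0) \<in> K"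
    using ad e by (auto simp: K_def B_def W_def less_imp_le)
  then have "K \<noteq> {}" by blast
  moreover have "continuous_on K (schedule_cost C T n)"
    unfolding schedule_cost_def C_def using b
    by (intro continuous_on_sum continuous_on_powr' coord continuous_on_const)
       (auto simp: K_def nnB intro!: sum_nonneg)
  ultimately obtain S where S: "S \<in> K"
    and min: "\<And>S'. S' \<in> K \<Longrightarrow> schedule_cost C T n S \<le> schedule_cost C T n S'"
    using continuous_attains_inf by metis
  have feas: "S \<in> feasible_schedules T n a d e"
    using S nnB by (auto simp: K_def feasible_schedules_def)
  have le: "schedule_cost C T n S \<le> schedule_cost C T n S'"
    if S': "S' \<in> feasible_schedules T n a d e" for S'
  proof -
    define R where "R = (\<lambda>j t. if W j t then S' j t else 0)"
    have nn: "0 \<le> S' j t" if "j \<in> {1..n}" "t \<in> {1..T}" for j t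
      using S' that by (auto simp: feasible_schedules_def)
    have nnW: "0 \<le> S' j t" if "W j t" for j t
      using nn[of j t] that ad[of j] by (force simp: W_def)
    have tot: "(\<Sum>t=a j..d j. S' j t) = e j" if "j \<in> {1..n}" for j
      using S' that by (auto simp: feasible_schedules_def)
    have "S' j t \<le> e j" if "W j t" for j t
      using member_le_sum[of t "{a j..d j}" "S' j"] tot[of j] nnW[of j] that
      by (auto simp: W_def)
    then have "R \<in> K"
      using nnW tot by (auto simp: K_def B_def R_def W_def)
    then have "schedule_cost C T n S \<le> schedule_cost C T n R" by (rule min)
    also have "\<dots> \<le> schedule_cost C T n S'"
      unfolding schedule_cost_def C_def using nn nnW b
      by (intro sum_mono powr_mono2 sum_nonneg) (auto simp: R_def)
    finally show ?thesis .
  qed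
  have "min_cost C T n a d e = schedule_cost C T n S"
    unfolding min_cost_def using feas le by (intro cInf_eq_minimum) auto
  then show ?thesis using feas le by blast
qed

end

theory Submission
  imports Defs
begin

text \<open>
  A job served in slot \<open>t\<close> spreads its energy, under any feasible schedule, over the fewer than
  \<open>2 l\<^sub>m\<^sub>a\<^sub>x\<close> slots \<open>u\<close> with \<open>\<bar>u - t\<bar> < l\<^sub>m\<^sub>a\<^sub>x\<close>. Let \<open>X t u\<close> be the energy that
  the schedule spends in slot \<open>u\<close> on the jobs attacked in slot \<open>t\<close>. The power mean inequality
  bounds the attacked load \<open>(\<Sum>u. X t u) powr b\<close> by
  \<open>(2 l\<^sub>m\<^sub>a\<^sub>x) powr (b - 1) * (\<Sum>u. X t u powr b)\<close>. Summing over \<open>t\<close>, superadditivity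
  of the power recombines the \<open>X t u\<close> into the loads of the schedule. This gives the sharper factor
  \<open>(2 l\<^sub>m\<^sub>a\<^sub>x) powr (b - 1)\<close>.
\<close>

text \<open>This is Jensen's inequality for the convex map \<open>y powr b\<close> with equal
  weights \<open>1 / m\<close> on the support; enlarging \<open>m\<close> to \<open>card A\<close>
  is harmless since \<open>b - 1 \<ge> 0\<close>.\<close>

lemma power_mean_powr:
  fixes x :: "'a \<Rightarrow> real"
  assumes "finite A" and "b \<ge> 1" and "\<And>i. i \<in> A \<Longrightarrow> x i \<ge> 0"
  shows "(\<Sum>i\<in>A. x i) powr b \<le> real (card A) powr (b - 1) * (\<Sum>i\<in>A. x i powr b)"
proof (cases "{i\<in>A. x i > 0} = {}")
  case True
  then have "x i = 0" if "i \<in> A" for i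
    using assms(3)[OF that] that by force
  then show ?thesis by simp
next
  case False
  \<comment> \<open>\<open>powr\<close> is shown convex on the positive reals only (\<open>powr_convex\<close>), hence the restriction to \<open>P\<close>.\<close>
  define P where "P = {i\<in>A. x i > 0}"
  define m where "m = real (card P)"
  have P: "finite P" "P \<noteq> {}" using assms(1) False by (auto simp: P_def)
  then have m: "m > 0" by (simp add: m_def card_gt_0_iff)
  have "card P \<le> card A" using assms(1) by (auto simp: P_def intro: card_mono)
  then have mA: "m \<le> real (card A)" by (simp add: m_def)
  have sum_P: "(\<Sum>i\<in>A. f (x i)) = (\<Sum>i\<in>P. f (x i))" if "f 0 = 0" for f :: "real \<Rightarrow> real"
    using assms(1,3) that by (intro sum.mono_neutral_right) (force simp: P_def)+
  have "(\<Sum>i\<in>P. (1 / m) *\<^sub>R x i) powr b \<le> (\<Sum>i\<in>P. (1 / m) * x i powr b)"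
    using P m by (intro convex_on_sum[OF _ _ powr_convex[OF assms(2)]]) (auto simp: m_def P_def)
  then have "((\<Sum>i\<in>P. x i) / m) powr b \<le> (\<Sum>i\<in>P. x i powr b) / m"
    by (simp add: sum_divide_distrib)
  then have "(\<Sum>i\<in>P. x i) powr b / m powr b \<le> (\<Sum>i\<in>P. x i powr b) / m"
    using m by (simp add: powr_divide)
  then have "(\<Sum>i\<in>P. x i) powr b \<le> m powr (b - 1) * (\<Sum>i\<in>P. x i powr b)"
    using m by (simp add: powr_diff field_simps)
  also have "\<dots> \<le> real (card A) powr (b - 1) * (\<Sum>i\<in>P. x i powr b)"
    using m mA assms(2) by (intro mult_right_mono powr_mono2 sum_nonneg) auto
  finally show ?thesis
    using sum_P[of "\<lambda>y. y"] sum_P[of "\<lambda>y. y powr b"] by simp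
qed

text \<open>Each term splits as \<open>x i * x i powr (b - 1)\<close>, and the second factor is at
  most the same power of the total \<open>M\<close>.\<close>

lemma sum_powr_le_powr_sum:
  fixes x :: "'a \<Rightarrow> real"
  assumes "finite A" and "b \<ge> 1" and nonneg: "\<And>i. i \<in> A \<Longrightarrow> x i \<ge> 0"
  shows "(\<Sum>i\<in>A. x i powr b) \<le> (\<Sum>i\<in>A. x i) powr b"
proof -
  define M where "M = (\<Sum>i\<in>A. x i)"
  have M: "M \<ge> 0" using nonneg by (simp add: M_def sum_nonneg)
  have split: "y powr b = y * y powr (b - 1)" if "y \<ge> 0" for y :: real
    using that powr_add[of y 1 "b - 1"] by simp
  have "(\<Sum>i\<in>A. x i powr b) \<le> (\<Sum>i\<in>A. x i * M powr (b - 1))"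
  proof (rule sum_mono)
    fix i assume i: "i \<in> A"
    then have "x i \<le> M"
      unfolding M_def using assms by (intro member_le_sum) auto
    then show "x i powr b \<le> x i * M powr (b - 1)"
      using nonneg[OF i] assms(2) by (simp add: split mult_left_mono powr_mono2)
  qed
  also have "\<dots> = M powr b"
    using M by (simp add: split M_def sum_distrib_right)
  finally show ?thesis by (simp add: M_def)
qed

lemma attack_cost_le_schedule_cost:
  fixes T n l :: nat and s a d :: "nat \<Rightarrow> nat" and e :: "nat \<Rightarrow> real" and b :: real
  assumes jobs: "\<And>j. j \<in> {1..n} \<Longrightarrow> 1 \<le> a j \<and> d j \<le> T \<and> d j - a j < l"
    and "b \<ge> 1"
    and S: "S \<in> feasible_schedules T n a d e"
    and s: "\<And>j. j \<in> {1..n} \<Longrightarrow> s j \<in> {a j..d j}"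
  shows "(\<Sum>t=1..T. (\<Sum>j\<in>{j\<in>{1..n}. s j = t}. e j) powr b)
    \<le> (2 * real l) powr (b - 1) * schedule_cost (\<lambda>E. E powr b) T n S"
proof -
  define X where "X t u = (\<Sum>j\<in>{j\<in>{1..n}. s j = t}. S j u)" for t u
  \<comment> \<open>The slots at distance less than \<open>l\<close> from \<open>t\<close>, cut to
    \<open>{1..T}\<close>, where schedules are known to be nonnegative. Truncated subtraction at the
    lower end loses no slot.\<close>
  define U where "U t = {1..T} \<inter> {t + 1 - l..<t + l}" for t
  have S_nonneg: "S j u \<ge> 0" if "j \<in> {1..n}" "u \<in> {1..T}" for j u
    using S that by (auto simp: feasible_schedules_def)
  have X_nonneg: "X t u \<ge> 0" if "u \<in> {1..T}" for t u
    unfolding X_def using S_nonneg that by (intro sum_nonneg) auto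
  have "(\<Sum>j\<in>{j\<in>{1..n}. s j = t}. e j) powr b
      \<le> (2 * real l) powr (b - 1) * (\<Sum>u=1..T. X t u powr b)" for t
  proof -
    have "e j \<le> (\<Sum>u\<in>U t. S j u)" if j: "j \<in> {1..n}" "s j = t" for j
    proof -
      have "e j = (\<Sum>u=a j..d j. S j u)"
        using S j by (auto simp: feasible_schedules_def)
      \<comment> \<open>The window \<open>{a j..d j}\<close> contains \<open>t\<close> and its ends
        differ by less than \<open>l\<close>, so it lies inside \<open>U t\<close>.\<close>
      also have "\<dots> \<le> (\<Sum>u\<in>U t. S j u)"
        using jobs[OF j(1)] s[OF j(1)] j S_nonneg
        by (intro sum_mono2) (auto simp: U_def)
      finally show ?thesis .
    qed
    then have "(\<Sum>j\<in>{j\<in>{1..n}. s j = t}. e j) \<le> (\<Sum>u\<in>U t. X t u)"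
      unfolding X_def by (subst sum.swap) (intro sum_mono, auto)
    \<comment> \<open>Monotonicity of \<open>powr\<close> needs a nonnegative base; the sign of
      \<open>e j\<close> is read off from the feasible schedule.\<close>
    moreover have "0 \<le> (\<Sum>j\<in>{j\<in>{1..n}. s j = t}. e j)"
    proof (intro sum_nonneg)
      fix j assume j: "j \<in> {j\<in>{1..n}. s j = t}"
      then have "e j = (\<Sum>u=a j..d j. S j u)"
        using S by (auto simp: feasible_schedules_def)
      also have "\<dots> \<ge> 0"
        using jobs[of j] j S_nonneg by (intro sum_nonneg) auto
      finally show "0 \<le> e j" .
    qed
    ultimately have "(\<Sum>j\<in>{j\<in>{1..n}. s j = t}. e j) powr b \<le> (\<Sum>u\<in>U t. X t u) powr b"
      using assms(2) by (intro powr_mono2) auto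
    also have "\<dots> \<le> real (card (U t)) powr (b - 1) * (\<Sum>u\<in>U t. X t u powr b)"
      using assms(2) X_nonneg by (intro power_mean_powr) (auto simp: U_def)
    also have "\<dots> \<le> (2 * real l) powr (b - 1) * (\<Sum>u=1..T. X t u powr b)"
    proof (intro mult_mono powr_mono2 sum_mono2)
      \<comment> \<open>The interval has at most \<open>2 * l - 1\<close> slots, rounded up to
        \<open>2 * l\<close>.\<close>
      have "card (U t) \<le> card {t + 1 - l..<t + l}"
        unfolding U_def by (intro card_mono) auto
      then show "real (card (U t)) \<le> 2 * real l" by simp
    qed (use assms(2) in \<open>auto simp: U_def sum_nonneg\<close>)
    finally show ?thesis .
  qed
  then have "(\<Sum>t=1..T. (\<Sum>j\<in>{j\<in>{1..n}. s j = t}. e j) powr b)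
      \<le> (\<Sum>t=1..T. (2 * real l) powr (b - 1) * (\<Sum>u=1..T. X t u powr b))"
    by (intro sum_mono)
  also have "\<dots> = (2 * real l) powr (b - 1) * (\<Sum>u=1..T. \<Sum>t=1..T. X t u powr b)"
    by (subst sum.swap) (simp add: sum_distrib_left)
  also have "\<dots> \<le> (2 * real l) powr (b - 1) * (\<Sum>u=1..T. (\<Sum>j=1..n. S j u) powr b)"
  proof (intro mult_left_mono sum_mono)
    fix u assume "u \<in> {1..T}"
    then have "(\<Sum>t=1..T. X t u powr b) \<le> (\<Sum>t=1..T. X t u) powr b"
      using assms(2) X_nonneg by (intro sum_powr_le_powr_sum) auto
    \<comment> \<open>Every job is attacked in exactly one slot \<open>s j\<close> of
      \<open>{1..T}\<close>, so the groups partition the jobs.\<close>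
    also have "(\<Sum>t=1..T. X t u) = (\<Sum>j=1..n. S j u)"
      unfolding X_def using s jobs by (intro sum.group) force+
    finally show "(\<Sum>t=1..T. X t u powr b) \<le> (\<Sum>j=1..n. S j u) powr b" .
  qed simp
  finally show ?thesis by (simp add: schedule_cost_def)
qed

theorem theorem4:
  fixes T n :: nat and a d :: "nat \<Rightarrow> nat" and e :: "nat \<Rightarrow> real" and b :: real
  assumes "n \<ge> 1"
    and "\<And>j. j \<in> {1..n} \<Longrightarrow> a j \<in> {1..T} \<and> d j \<in> {1..T} \<and> a j \<le> d j"
    and "\<And>j. j \<in> {1..n} \<Longrightarrow> e j > 0"
    and "b \<ge> 2"
  shows "full_attack_max_cost (\<lambda>E. E powr b) T n a d e
    \<le> 2 powr (b - 1) * (real (max_allowance n a d) + 1) powr b * b powr b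
      * min_cost (\<lambda>E. E powr b) T n a d e"
proof -
  define l where "l = max_allowance n a d"
  obtain S where S: "S \<in> feasible_schedules T n a d e"
    and min: "min_cost (\<lambda>E. E powr b) T n a d e = schedule_cost (\<lambda>E. E powr b) T n S"
    using min_cost_attained[of b n a d T e] assms by auto
  have jobs: "1 \<le> a j \<and> d j \<le> T \<and> d j - a j < l" if j: "j \<in> {1..n}" for j
  proof -
    have "d j - a j + 1 \<le> l"
      unfolding l_def max_allowance_def using j by (intro Max_ge) auto
    then show ?thesis using assms(2)[OF j] by auto
  qed
  \<comment> \<open>The sharper factor is relaxed to the claimed one: \<open>l\<close> grows to
    \<open>l + 1\<close>, its exponent grows to \<open>b\<close>, and
    \<open>b powr b \<ge> 1\<close>.\<close>
  have "(2 * real l) powr (b - 1) = 2 powr (b - 1) * real l powr (b - 1)"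
    by (simp add: powr_mult)
  also have "\<dots> \<le> 2 powr (b - 1) * (real l + 1) powr b"
  proof (intro mult_left_mono)
    have "real l powr (b - 1) \<le> (real l + 1) powr (b - 1)"
      using assms(4) by (intro powr_mono2) auto
    also have "\<dots> \<le> (real l + 1) powr b" by (intro powr_mono) auto
    finally show "real l powr (b - 1) \<le> (real l + 1) powr b" .
  qed simp
  also have "\<dots> \<le> 2 powr (b - 1) * (real l + 1) powr b * b powr b"
    using mult_left_mono[of 1 "b powr b" "2 powr (b - 1) * (real l + 1) powr b"]
      assms(4) ge_one_powr_ge_zero[of b b] by simp
  finally have factor: "(2 * real l) powr (b - 1)
      \<le> 2 powr (b - 1) * (real l + 1) powr b * b powr b" .
  have cost_nonneg: "schedule_cost (\<lambda>E. E powr b) T n S \<ge> 0"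
    by (simp add: schedule_cost_def sum_nonneg)
  have "(\<Sum>t=1..T. (\<Sum>j\<in>{j\<in>{1..n}. s j = t}. e j) powr b)
      \<le> 2 powr (b - 1) * (real l + 1) powr b * b powr b * schedule_cost (\<lambda>E. E powr b) T n S"
    if "s \<in> (\<Pi>\<^sub>E j\<in>{1..n}. {a j..d j})" for s
    using attack_cost_le_schedule_cost[OF jobs _ S, of b s] that assms(4)
      mult_right_mono[OF factor cost_nonneg]
    by (force simp: PiE_iff)
  moreover have "(\<Pi>\<^sub>E j\<in>{1..n}. {a j..d j}) \<noteq> {}"
    using assms(2) by (auto simp: PiE_eq_empty_iff)
  ultimately show ?thesis
    unfolding full_attack_max_cost_def min l_def[symmetric]
    by (subst Max_le_iff) (auto intro: finite_PiE)
qed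

end
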